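(* Let $n\geq 1$ and let $\alpha>0$ be such that $d_\alpha$ is a distance on $\mathbb H^n$. Then the Besicovitch Covering Property (BCP) holds for $d_\alpha$ on $\mathbb H^n$.
   Context: The Heisenberg group $\mathbb H^n$ is $\mathbb R^{2n+1}=\{(x,y,z): x,y\in\mathbb R^n, z\in\mathbb R\}$ with the Euclidean topology and group law $(x,y,z)\cdot(x',y',z')=(x+x',y+y',z+z'+\tfrac12\langle x,y'\rangle-\tfrac12\langle y,x'\rangle)$; the inverse of $(x,y,z)$ is $(-x,-y,-z)$. Dilations are $\delta_\lambda(x,y,z)=(\lambda x,\lambda y,\lambda^2 z)$, $\lambda>0$. For $\alpha>0$ let $B_\alpha=\{(x,y,z):\|x\|^2+\|y\|^2+z^2\leq\alpha^2\}$ (closed Euclidean ball) and define $d_\alpha(p,q)=\inf\{r>0:\delta_{1/r}(p^{-1}\cdot q)\in B_\alpha\}$. Balls are closed: $B_d(p,r)=\{q: d(q,p)\le r\}$, each ball coming with a fixed center and radius. BCP holds for a distance $d$ on $M$ if there is an integer $N\geq1$ such that for every bounded $A\subset M$ and every family $\mathcal B$ of balls such that each point of $A$ is the center of some ball of $\mathcal B$, there is a subfamily $\mathcal F\subset\mathcal B$ with $\chi_A\leq\sum_{B\in\mathcal F}\chi_B\leq N$. *)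

theory Defs
  imports "HOL-Analysis.Analysis"
begin

text \<open>The Heisenberg group H^n, with n = CARD('n) \<ge> 1, as triples (x,y,z) with x,y in R^n, z in R.\<close>

type_synonym 'n heis = "(real^'n) \<times> (real^'n) \<times> real"

definition heis_mult :: "'n::finite heis \<Rightarrow> 'n heis \<Rightarrow> 'n heis" where
  "heis_mult p q = (case p of (x, y, z) \<Rightarrow> case q of (x', y', z') \<Rightarrow>
      (x + x', y + y', z + z' + (1/2) * (x \<bullet> y') - (1/2) * (y \<bullet> x')))"

definition heis_inv :: "'n::finite heis \<Rightarrow> 'n heis" where
  "heis_inv p = (case p of (x, y, z) \<Rightarrow> (-x, -y, -z))"

definition heis_dil :: "real \<Rightarrow> 'n::finite heis \<Rightarrow> 'n heis" where
  "heis_dil t p = (case p of (x, y, z) \<Rightarrow> (t *\<^sub>R x, t *\<^sub>R y, t\<^sup>2 * z))"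

definition B_alpha :: "real \<Rightarrow> 'n::finite heis set" where
  "B_alpha \<alpha> = {(x, y, z). norm x ^ 2 + norm y ^ 2 + z ^ 2 \<le> \<alpha> ^ 2}"

definition d_alpha :: "real \<Rightarrow> 'n::finite heis \<Rightarrow> 'n heis \<Rightarrow> real" where
  "d_alpha \<alpha> p q = Inf {r. r > 0 \<and> heis_dil (1 / r) (heis_mult (heis_inv p) q) \<in> B_alpha \<alpha>}"

definition is_distance :: "('a \<Rightarrow> 'a \<Rightarrow> real) \<Rightarrow> bool" where
  "is_distance d \<longleftrightarrow>
     (\<forall>p q. 0 \<le> d p q) \<and> (\<forall>p q. d p q = 0 \<longleftrightarrow> p = q) \<and> (\<forall>p q. d p q = d q p) \<and>
     (\<forall>p q s. d p s \<le> d p q + d q s)"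

definition cball_d :: "('a \<Rightarrow> 'a \<Rightarrow> real) \<Rightarrow> 'a \<times> real \<Rightarrow> 'a set" where
  "cball_d d b = {q. d q (fst b) \<le> snd b}"

definition bounded_d :: "('a \<Rightarrow> 'a \<Rightarrow> real) \<Rightarrow> 'a set \<Rightarrow> bool" where
  "bounded_d d A \<longleftrightarrow> (\<exists>p R. \<forall>a\<in>A. d a p \<le> R)"

text \<open>Besicovitch Covering Property. Balls are pairs (center, radius) with positive radius;
  the condition sum of indicators \<le> N is: every point lies in at most N (finitely many) balls of F.\<close>
definition BCP :: "('a \<Rightarrow> 'a \<Rightarrow> real) \<Rightarrow> bool" where
  "BCP d \<longleftrightarrow> (\<exists>N::nat. N \<ge> 1 \<and>
     (\<forall>A \<B>. bounded_d d A \<longrightarrow> (\<forall>b\<in>\<B>. snd b > 0) \<longrightarrow> (\<forall>a\<in>A. \<exists>r. (a, r) \<in> \<B>) \<longrightarrow>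
        (\<exists>\<F> \<subseteq> \<B>. (\<forall>a\<in>A. \<exists>b\<in>\<F>. a \<in> cball_d d b) \<and>
           (\<forall>q. finite {b\<in>\<F>. q \<in> cball_d d b} \<and> card {b\<in>\<F>. q \<in> cball_d d b} \<le> N))))"

end

theory Submission
  imports Defs
begin

text \<open>For a doubling distance, BCP reduces to a bound on the number of points p around a fixed q
  that are pairwise further apart than from q. Translate q to the origin and dilate each p to a point
  (w,t) of the Euclidean sphere of radius \<open>\<alpha>\<close>. If two such points have almost the same
  (w,t) and almost the same direction of w, then one of them lies in the ball around the other that
  passes through the origin: after dilation this says that
  |w' - s w|^2 + (t' - s^2 t - s \<open>\<omega>\<close>(w,w')/2)^2 is at most \<open>\<alpha>\<close>^2 = |w'|^2 + t'^2
  for \<open>0 < s \<le> 1\<close>, which follows from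
  2<w,w'> + t' \<open>\<omega>\<close>(w,w') + 2stt' being at least s(|w|^2 + (st + \<open>\<omega>\<close>(w,w')/2)^2).
  Compactness bounds the number of classes of such points.\<close>

section \<open>Greedy selection\<close>

text \<open>Transfinite greedy choice: whether b is kept depends only on its
  \<open>Q\<close>-predecessors, so well-founded recursion decides it.\<close>

lemma wf_kernel_exists:
  assumes "wf Q"
  shows "\<exists>S\<subseteq>A. \<forall>b\<in>A. b \<in> S \<longleftrightarrow> (\<forall>a\<in>S. (a, b) \<notin> Q)"
proof -
  define sel where "sel = wfrec Q (\<lambda>sel b. b \<in> A \<and> (\<forall>a. (a, b) \<in> Q \<longrightarrow> \<not> sel a))"
  have sel: "sel b \<longleftrightarrow> b \<in> A \<and> (\<forall>a. (a, b) \<in> Q \<longrightarrow> \<not> sel a)" for b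
  proof -
    have "sel b \<longleftrightarrow> b \<in> A \<and> (\<forall>a. (a, b) \<in> Q \<longrightarrow> \<not> cut sel Q b a)"
      unfolding sel_def by (subst wfrec[OF assms]) simp
    then show ?thesis by (simp add: cut_apply cong: conj_cong imp_cong)
  qed
  show ?thesis
    unfolding Ball_def by (intro exI[of _ "{b. sel b}"]) (use sel in blast)
qed

text \<open>The least k with \<open>R / 2 ^ Suc k < r\<close> works: minimality gives the upper
  bound, which for k = 0 is r \<le> R itself.\<close>

lemma dyadic_level_exists:
  fixes r R :: real
  assumes "0 < r" "r \<le> R"
  shows "\<exists>k. R / 2 ^ Suc k < r \<and> r \<le> R / 2 ^ k"
proof -
  have "\<exists>k. R / 2 ^ Suc k < r"
  proof -
    obtain k where "R / r < 2 ^ k"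
      using real_arch_pow[of 2 "R / r"] by auto
    then have "R / 2 ^ k < r"
      using assms by (simp add: field_simps)
    moreover have "R / 2 ^ Suc k \<le> R / 2 ^ k"
      using assms by (simp add: field_simps)
    ultimately show ?thesis by (meson le_less_trans)
  qed
  then obtain k where k: "R / 2 ^ Suc k < r" "\<And>j. R / 2 ^ Suc j < r \<Longrightarrow> k \<le> j"
    using exists_least_iff[of "\<lambda>k. R / 2 ^ Suc k < r"] by (meson not_less)
  have "r \<le> R / 2 ^ k"
  proof (cases k)
    case 0
    then show ?thesis using assms by simp
  next
    case (Suc j)
    then show ?thesis using k(2)[of j] by force
  qed
  with k(1) show ?thesis by blast
qed

text \<open>Packing form of doubling. Finiteness is a separate conjunct because \<open>card\<close>
  of an infinite set is 0.\<close>

definition doubling_d :: "('a \<Rightarrow> 'a \<Rightarrow> real) \<Rightarrow> nat \<Rightarrow> bool" where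
  "doubling_d d C \<longleftrightarrow> (\<forall>q r S. r > 0 \<longrightarrow> (\<forall>p\<in>S. d q p \<le> r) \<longrightarrow>
     (\<forall>p\<in>S. \<forall>p'\<in>S. p \<noteq> p' \<longrightarrow> d p p' > r / 2) \<longrightarrow> finite S \<and> card S \<le> C)"

text \<open>A family of balls containing q, none of whose centers lies in another ball of the family, can
  be shrunk until q is on the boundary of every ball; only the centers then matter.\<close>

definition weak_BCP :: "('a \<Rightarrow> 'a \<Rightarrow> real) \<Rightarrow> nat \<Rightarrow> bool" where
  "weak_BCP d N \<longleftrightarrow> (\<forall>q S. (\<forall>p\<in>S. \<forall>p'\<in>S. p \<noteq> p' \<longrightarrow> d p p' > max (d q p) (d q p'))
     \<longrightarrow> finite S \<and> card S \<le> N)"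

text \<open>Centers are selected greedily, larger dyadic radius levels first. At a given point, the doubling
  hypothesis bounds the number of selected balls within one level, and the weak Besicovitch
  hypothesis bounds the number of levels, since selected centers from different levels do not lie
  in each other's balls.\<close>

theorem BCP_if_doubling_weak_BCP:
  fixes d :: "'a \<Rightarrow> 'a \<Rightarrow> real"
  assumes dist: "is_distance d" and doubling: "doubling_d d C" and weak: "weak_BCP d N"
  shows "BCP d"
  unfolding BCP_def
\<comment> \<open>The extra 1 makes the constant positive and covers the case of a single ball even
  when \<open>N * C\<close> is 0.\<close>
proof (intro exI[of _ "N * C + 1"] conjI allI impI)
  fix A :: "'a set" and \<B> :: "('a \<times> real) set"
  assume bdd: "bounded_d d A" and pos: "\<forall>b\<in>\<B>. snd b > 0" and "\<forall>a\<in>A. \<exists>r. (a, r) \<in> \<B>"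
  then obtain r where rB: "\<And>a. a \<in> A \<Longrightarrow> (a, r a) \<in> \<B>"
    by metis
  then have rpos: "\<And>a. a \<in> A \<Longrightarrow> r a > 0"
    using pos by fastforce
  have sym: "d p q = d q p" and tri: "d p s \<le> d p q + d q s" for p q s
    using dist by (auto simp: is_distance_def)
  obtain p0 R0 where R0: "\<And>a. a \<in> A \<Longrightarrow> d a p0 \<le> R0"
    using bdd by (auto simp: bounded_d_def)
  define R where "R = 2 * R0"
  have AR: "d a b \<le> R" if "a \<in> A" "b \<in> A" for a b
    using tri[of a b p0] sym[of p0 b] R0[OF that(1)] R0[OF that(2)] by (simp add: R_def)
  show "\<exists>\<F>\<subseteq>\<B>. (\<forall>a\<in>A. \<exists>b\<in>\<F>. a \<in> cball_d d b) \<and>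
      (\<forall>q. finite {b\<in>\<F>. q \<in> cball_d d b} \<and> card {b\<in>\<F>. q \<in> cball_d d b} \<le> N * C + 1)"
  \<comment> \<open>Points of A are at most R apart, so one ball of radius at least R covers A
    alone; otherwise all radii are below R and have dyadic levels.\<close>
  proof (cases "\<exists>a\<in>A. r a \<ge> R")
    case True
    then obtain a where a: "a \<in> A" "r a \<ge> R" by blast
    have "card {b\<in>{(a, r a)}. q \<in> cball_d d b} \<le> 1" for q
      using card_mono[of "{(a, r a)}" "{b\<in>{(a, r a)}. q \<in> cball_d d b}"] by auto
    moreover have "\<forall>b\<in>A. b \<in> cball_d d (a, r a)"
      using AR a by (force simp: cball_d_def)
    ultimately show ?thesis
      using rB[OF a(1)] by (intro exI[of _ "{(a, r a)}"]) (auto intro: order.trans)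
  next
    case False
    then have "\<And>a. a \<in> A \<Longrightarrow> \<exists>k. R / 2 ^ Suc k < r a \<and> r a \<le> R / 2 ^ k"
      using rpos by (intro dyadic_level_exists) force+
    then obtain k where k: "\<And>a. a \<in> A \<Longrightarrow> R / 2 ^ Suc (k a) < r a \<and> r a \<le> R / 2 ^ k a"
      by metis
    obtain wo :: "'a rel" where wo: "Well_order wo" "Field wo = UNIV"
      using well_ordering[where 'a='a] by blast
    \<comment> \<open>Small k means large radius, so big balls come first; the well-order only
      breaks ties within a level.\<close>
    define W where "W = inv_image (less_than <*lex*> (wo - Id)) (\<lambda>a. (k a, a))"
    have wfW: "wf W"
      unfolding W_def using wo by (intro wf_inv_image wf_lex_prod) (auto simp: well_order_on_def)
    have totW: "(a, b) \<in> W \<or> (b, a) \<in> W" if "a \<noteq> b" for a b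
      using wo that unfolding W_def
      by (auto simp: well_order_on_def linear_order_on_def total_on_def)
    \<comment> \<open>The kernel of \<open>Q\<close> is the greedy choice: a center is kept exactly
      when no earlier kept ball contains it.\<close>
    define Q where "Q = {(a, b) \<in> W. d b a \<le> r a}"
    have "wf Q"
      by (rule wf_subset[OF wfW]) (auto simp: Q_def)
    then obtain S where S: "S \<subseteq> A" "\<And>b. b \<in> A \<Longrightarrow> b \<in> S \<longleftrightarrow> (\<forall>a\<in>S. (a, b) \<notin> Q)"
      using wf_kernel_exists[of Q A] by blast
    have sepW: "d a b > r a" if "a \<in> S" "b \<in> S" "(a, b) \<in> W" for a b
      using S that sym[of a b] by (fastforce simp: Q_def)
    have cover: "\<exists>a\<in>S. d b a \<le> r a" if "b \<in> A" for b
    proof (cases "b \<in> S")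
      case True
      have "d b b = 0" using dist by (simp add: is_distance_def)
      then show ?thesis using True rpos[OF that] by (intro bexI[of _ b]) auto
    next
      case False
      then show ?thesis using S(2)[OF that] by (auto simp: Q_def)
    qed
    \<comment> \<open>Whichever center comes first, its radius exceeds half of the level's upper
      bound; this is the separation in \<open>doubling_d\<close> at scale
      \<open>R / 2 ^ k a\<close>.\<close>
    have same: "d a b > R / 2 ^ k a / 2" if "a \<in> S" "b \<in> S" "a \<noteq> b" "k a = k b" for a b
    proof -
      have *: "d a b > R / 2 ^ k a / 2" if "a \<in> S" "b \<in> S" "(a, b) \<in> W" for a b
      proof -
        have "R / 2 ^ k a / 2 = R / 2 ^ Suc (k a)" by simp
        then show ?thesis
          using sepW[OF that] k[of a] S(1) that(1) by fastforce
      qed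
      show ?thesis
        using totW[OF \<open>a \<noteq> b\<close>] *[of a b] *[of b a] that sym[of a b] by auto
    qed
    have Rpos: "R > 0" if "a \<in> A" for a
      using rpos[OF that] False that by force
    \<comment> \<open>\<open>sepW\<close> excludes one direction only, but the earlier ball is the
      larger one, so its radius already is the maximum.\<close>
    have diff: "d a b > max (r a) (r b)" if "a \<in> S" "b \<in> S" "k a \<noteq> k b" for a b
    proof -
      have *: "d a b > max (r a) (r b)" if "a \<in> S" "b \<in> S" "k a < k b" for a b
      proof -
        have "(a, b) \<in> W" using that by (simp add: W_def)
        then have "d a b > r a" using sepW that by blast
        moreover have "R / 2 ^ k b \<le> R / 2 ^ Suc (k a)"
          using that Rpos[of a] S(1) by (intro divide_left_mono power_increasing) auto
        then have "r b < r a"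
          using k[of a] k[of b] that S(1) by force
        ultimately show ?thesis by simp
      qed
      show ?thesis
        using *[of a b] *[of b a] that sym[of a b] by (cases "k a < k b") (auto simp: max.commute)
    qed
    have mult: "finite {p\<in>S. d q p \<le> r p} \<and> card {p\<in>S. d q p \<le> r p} \<le> N * C" for q
    proof -
      let ?Q = "{p\<in>S. d q p \<le> r p}"
      \<comment> \<open>\<open>T\<close> has one center for each level present at q, so a bound on
        \<open>T\<close> bounds the number of levels.\<close>
      obtain T where T: "T \<subseteq> ?Q" "k ` ?Q = k ` T" "inj_on k T"
        using subset_image_inj[of "k ` ?Q" k ?Q] by auto
      have "finite T \<and> card T \<le> N"
      proof (rule weak[unfolded weak_BCP_def, rule_format, of T q])
        fix p p' assume p: "p \<in> T" "p' \<in> T" "p \<noteq> p'"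
        then have "k p \<noteq> k p'" using T(3) by (auto simp: inj_on_def)
        then have "d p p' > max (r p) (r p')" using diff p T(1) by blast
        then show "d p p' > max (d q p) (d q p')" using p T(1) by fastforce
      qed
      then have levels: "finite (k ` ?Q)" "card (k ` ?Q) \<le> N"
        using T card_image_le[of T k] by auto
      have level: "finite {p\<in>?Q. k p = j} \<and> card {p\<in>?Q. k p = j} \<le> C" for j
      \<comment> \<open>An empty level has no member from which to derive R > 0, so it is treated
        apart.\<close>
      proof (cases "{p\<in>?Q. k p = j} = {}")
        case True
        then show ?thesis by (metis card.empty finite.emptyI le0)
      next
        case False
        then have "R > 0" using Rpos S(1) by blast
        then show ?thesis
        proof (intro doubling[unfolded doubling_d_def, rule_format, of "R / 2 ^ j" _ q])
          fix p assume "p \<in> {p\<in>?Q. k p = j}"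
          then show "d q p \<le> R / 2 ^ j" using k[of p] S(1) by force
        next
          fix p p' assume "p \<in> {p\<in>?Q. k p = j}" "p' \<in> {p\<in>?Q. k p = j}" "p \<noteq> p'"
          then show "d p p' > R / 2 ^ j / 2" using same[of p p'] by auto
        qed auto
      qed
      have Q: "?Q = (\<Union>j\<in>k ` ?Q. {p\<in>?Q. k p = j})" by auto
      have "finite ?Q"
        by (subst Q, rule finite_UN_I) (use levels level in auto)
      moreover have "card ?Q \<le> (\<Sum>j\<in>k ` ?Q. card {p\<in>?Q. k p = j})"
        by (subst Q, rule card_UN_le[OF levels(1)])
      then have "card ?Q \<le> card (k ` ?Q) * C"
        using sum_bounded_above[of "k ` ?Q" "\<lambda>j. card {p\<in>?Q. k p = j}" C] level
        by (auto intro: order.trans)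
      then have "card ?Q \<le> N * C"
        using levels(2) by (meson mult_le_mono1 order.trans)
      ultimately show ?thesis by blast
    qed
    let ?F = "(\<lambda>a. (a, r a)) ` S"
    have F: "{b\<in>?F. q \<in> cball_d d b} = (\<lambda>a. (a, r a)) ` {p\<in>S. d q p \<le> r p}" for q
      by (auto simp: cball_d_def)
    have "finite {b\<in>?F. q \<in> cball_d d b} \<and> card {b\<in>?F. q \<in> cball_d d b} \<le> N * C + 1" for q
      unfolding F using mult[of q] card_image_le[of "{p\<in>S. d q p \<le> r p}" "\<lambda>a. (a, r a)"] by auto
    moreover have "?F \<subseteq> \<B>" using rB S(1) by blast
    moreover have "\<forall>a\<in>A. \<exists>b\<in>?F. a \<in> cball_d d b"
      using cover by (fastforce simp: cball_d_def)
    ultimately show ?thesis by blast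
  qed
qed simp

section \<open>The symplectic form and the balls of the metric\<close>

text \<open>Half of this form is the vertical correction in \<open>heis_mult\<close>.\<close>

definition symp :: "'b::real_inner \<times> 'b \<Rightarrow> 'b \<times> 'b \<Rightarrow> real" where
  "symp v w = fst v \<bullet> snd w - snd v \<bullet> fst w"

lemma symp_self [simp]: "symp v v = 0"
  by (simp add: symp_def inner_commute)

lemma symp_diff: "symp (v - v') w = symp v w - symp v' w" "symp v (w - w') = symp v w - symp v w'"
  by (simp_all add: symp_def inner_diff)

lemma symp_scaleR: "symp (a *\<^sub>R v) w = a * symp v w" "symp v (a *\<^sub>R w) = a * symp v w"
  by (simp_all add: symp_def algebra_simps)

lemma symp_swap: "symp w v = - symp v w"
  by (simp add: symp_def inner_commute)

text \<open>\<open>symp v w\<close> is the inner product of v with the image of w under the isometry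
  (a, b) -> (b, -a), so Cauchy-Schwarz applies.\<close>

lemma abs_symp_le: "\<bar>symp v w\<bar> \<le> norm v * norm w"
proof -
  have "symp v w = v \<bullet> (snd w, - fst w)"
    by (simp add: symp_def inner_prod_def)
  also have "\<bar>\<dots>\<bar> \<le> norm v * norm (snd w, - fst w)"
    by (rule Cauchy_Schwarz_ineq2)
  also have "norm (snd w, - fst w) = norm w"
    by (cases w) (simp add: norm_Pair add.commute)
  finally show ?thesis .
qed

lemma abs_symp_le_diff: "\<bar>symp v w\<bar> \<le> norm v * norm (v - w)"
  using abs_symp_le[of v "v - w"] by (simp add: symp_diff)

text \<open>The horizontal and vertical coordinates of the left translate of p by the inverse of q.\<close>

definition hor :: "'n::finite heis \<Rightarrow> 'n heis \<Rightarrow> (real^'n) \<times> (real^'n)" where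
  "hor q p = (fst p, fst (snd p)) - (fst q, fst (snd q))"

definition ver :: "'n::finite heis \<Rightarrow> 'n heis \<Rightarrow> real" where
  "ver q p = snd (snd p) - snd (snd q) - symp (fst q, fst (snd q)) (fst p, fst (snd p)) / 2"

text \<open>Left invariance: with \<open>ver_translate\<close>, this expresses coordinates based at
  p by those based at a common q.\<close>

lemma hor_translate: "hor p p' = hor q p' - hor q p"
  by (simp add: hor_def)

lemma ver_translate: "ver p p' = ver q p' - ver q p - symp (hor q p) (hor q p') / 2"
  using symp_swap[of "(fst p, fst (snd p))" "(fst q, fst (snd q))"]
  unfolding ver_def hor_def symp_diff symp_self diff_divide_distrib by simp

lemma hor_ver_eq_0: "hor q p = 0 \<Longrightarrow> ver q p = 0 \<Longrightarrow> p = q"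
proof -
  assume "hor q p = 0" "ver q p = 0"
  moreover from this(1) have "fst p = fst q" "fst (snd p) = fst (snd q)"
    by (simp_all add: hor_def zero_prod_def)
  ultimately show ?thesis
    by (simp add: ver_def prod_eq_iff)
qed

section \<open>The gauge under dilations and the closed balls\<close>

lemma gauge_antimono:
  fixes a b r s :: real
  assumes "0 < r" "r \<le> s"
  shows "(a / s)\<^sup>2 + (b / s\<^sup>2)\<^sup>2 \<le> (a / r)\<^sup>2 + (b / r\<^sup>2)\<^sup>2"
  using assms unfolding power_divide
  by (intro add_mono divide_left_mono power_mono mult_pos_pos zero_less_power) auto

text \<open>Strictness rules out a second radius at which a nonzero point dilates onto the
  sphere.\<close>

lemma gauge_strict_antimono:
  fixes a b r s :: real
  assumes "0 < r" "r < s" "a \<noteq> 0 \<or> b \<noteq> 0"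
  shows "(a / s)\<^sup>2 + (b / s\<^sup>2)\<^sup>2 < (a / r)\<^sup>2 + (b / r\<^sup>2)\<^sup>2"
proof -
  have le: "(a / s)\<^sup>2 \<le> (a / r)\<^sup>2" "(b / s\<^sup>2)\<^sup>2 \<le> (b / r\<^sup>2)\<^sup>2"
    using assms unfolding power_divide
    by (intro divide_left_mono power_mono mult_pos_pos zero_less_power; simp)+
  have "(a / s)\<^sup>2 < (a / r)\<^sup>2" if "a \<noteq> 0"
    using assms that unfolding power_divide
    by (intro divide_strict_left_mono power_strict_mono mult_pos_pos) auto
  moreover have "(b / s\<^sup>2)\<^sup>2 < (b / r\<^sup>2)\<^sup>2" if "b \<noteq> 0"
    using assms that unfolding power_divide
    by (intro divide_strict_left_mono power_strict_mono mult_pos_pos) auto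
  ultimately show ?thesis using le assms(3) by linarith
qed

lemma gauge_tendsto_0: "((\<lambda>r. (a / r)\<^sup>2 + (b / r\<^sup>2)\<^sup>2) \<longlongrightarrow> (0::real)) at_top"
proof -
  have "((\<lambda>r. (a / r)\<^sup>2 + (b / r\<^sup>2)\<^sup>2) \<longlongrightarrow> 0\<^sup>2 + (0::real)\<^sup>2) at_top"
    by (intro tendsto_intros tendsto_divide_0[OF tendsto_const] filterlim_at_top_imp_at_infinity
        filterlim_ident filterlim_pow_at_top) auto
  then show ?thesis by simp
qed

text \<open>With X = r^2 the equation reads \<alpha>^2 X^2 - a^2 X - b^2 = 0; \<open>D\<close> is
  its discriminant and \<open>X\<close> its positive root.\<close>

lemma gauge_radius_exists:
  fixes a b \<alpha> :: real
  assumes "\<alpha> > 0" "a \<noteq> 0 \<or> b \<noteq> 0"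
  obtains r where "r > 0" "(a / r)\<^sup>2 + (b / r\<^sup>2)\<^sup>2 = \<alpha>\<^sup>2"
proof -
  define D where "D = a ^ 4 + 4 * \<alpha>\<^sup>2 * b\<^sup>2"
  define X where "X = (a\<^sup>2 + sqrt D) / (2 * \<alpha>\<^sup>2)"
  have D0: "D \<ge> 0" by (simp add: D_def)
  have "D > 0"
  proof (cases "a = 0")
    case True
    then show ?thesis using assms by (simp add: D_def)
  next
    case False
    then have "a ^ 4 > 0" by simp
    then show ?thesis by (simp add: D_def add_pos_nonneg)
  qed
  then have X: "X > 0"
    using assms by (simp add: X_def add_nonneg_pos)
  have "2 * \<alpha>\<^sup>2 * X - a\<^sup>2 = sqrt D"
    using assms by (simp add: X_def)
  then have "(2 * \<alpha>\<^sup>2 * X - a\<^sup>2)\<^sup>2 = D"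
    using D0 by simp
  then have "4 * \<alpha>\<^sup>2 * (\<alpha>\<^sup>2 * X\<^sup>2) = 4 * \<alpha>\<^sup>2 * (a\<^sup>2 * X + b\<^sup>2)"
    unfolding D_def by algebra
  then have "\<alpha>\<^sup>2 * X\<^sup>2 = a\<^sup>2 * X + b\<^sup>2"
    using assms(1) by simp
  then have "a\<^sup>2 / X + b\<^sup>2 / X\<^sup>2 = \<alpha>\<^sup>2"
    using X by (simp add: field_simps power2_eq_square)
  with X show ?thesis
    by (intro that[of "sqrt X"]) (auto simp: power_divide)
qed

text \<open>Admissible radii form an up-set by \<open>gauge_antimono\<close>. An infimum at most r
  makes every s > r admissible, and r itself follows as a right limit by continuity.\<close>

lemma d_alpha_le_iff:
  fixes p q :: "'n::finite heis"
  assumes "\<alpha> > 0" "r > 0"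
  shows "d_alpha \<alpha> p q \<le> r \<longleftrightarrow> (norm (hor p q) / r)\<^sup>2 + (ver p q / r\<^sup>2)\<^sup>2 \<le> \<alpha>\<^sup>2"
proof -
  define g where "g = (\<lambda>s. (norm (hor p q) / s)\<^sup>2 + (ver p q / s\<^sup>2)\<^sup>2)"
  define G where "G = {s. s > 0 \<and> g s \<le> \<alpha>\<^sup>2}"
  have mem: "heis_dil (1 / s) (heis_mult (heis_inv p) q) \<in> B_alpha \<alpha> \<longleftrightarrow> g s \<le> \<alpha>\<^sup>2" if "s > 0" for s
  proof -
    obtain x y z x' y' z' where pq: "p = (x, y, z)" "q = (x', y', z')"
      by (metis prod.exhaust)
    have h: "(norm (hor p q))\<^sup>2 = (norm (x' - x))\<^sup>2 + (norm (y' - y))\<^sup>2"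
      by (simp add: hor_def pq norm_Pair)
    have v: "ver p q = - z + z' + (1/2) * (- x \<bullet> y') - (1/2) * (- y \<bullet> x')"
      by (simp add: ver_def pq symp_def field_simps)
    have "heis_dil (1 / s) (heis_mult (heis_inv p) q)
        = ((1 / s) *\<^sub>R (x' - x), (1 / s) *\<^sub>R (y' - y), (1 / s)\<^sup>2 * ver p q)"
      unfolding v by (simp add: pq heis_dil_def heis_mult_def heis_inv_def)
    moreover have "g s = (norm ((1 / s) *\<^sub>R (x' - x)))\<^sup>2 + (norm ((1 / s) *\<^sub>R (y' - y)))\<^sup>2
        + ((1 / s)\<^sup>2 * ver p q)\<^sup>2"
      using that unfolding g_def power_divide h
      by (simp add: power_divide power_mult_distrib add_divide_distrib)
    ultimately show ?thesis
      by (simp add: B_alpha_def)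
  qed
  have d: "d_alpha \<alpha> p q = Inf G"
    unfolding d_alpha_def G_def using mem by (metis (no_types, lifting))
  have "\<forall>\<^sub>F s in at_top. g s < \<alpha>\<^sup>2"
    unfolding g_def by (rule order_tendstoD(2)[OF gauge_tendsto_0]) (use assms in simp)
  then have "\<forall>\<^sub>F s in at_top. s > 0 \<and> g s < \<alpha>\<^sup>2"
    using eventually_gt_at_top eventually_conj by blast
  then obtain s0 where "s0 > 0" "g s0 < \<alpha>\<^sup>2"
    using eventually_happens'[OF trivial_limit_at_top_linorder] by blast
  then have ne: "G \<noteq> {}" by (auto simp: G_def)
  have bdd: "bdd_below G" by (auto simp: G_def intro: bdd_belowI[of _ 0])
  show ?thesis
  proof
    assume *: "d_alpha \<alpha> p q \<le> r"
    have ev: "g s \<le> \<alpha>\<^sup>2" if s: "s > r" for s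
    proof -
      have "Inf G < s" using * d s by simp
      then obtain u where "u \<in> G" "u < s" using cInf_lessD[OF ne] by blast
      then show ?thesis
        using gauge_antimono[of u s "norm (hor p q)" "ver p q"] by (simp add: G_def g_def)
    qed
    have "isCont g r" unfolding g_def using assms by (intro continuous_intros) auto
    then have "(g \<longlongrightarrow> g r) (at_right r)"
      by (simp add: continuous_at_imp_continuous_at_within continuous_within isCont_def filterlim_at_split)
    moreover have "\<forall>\<^sub>F s in at_right r. g s \<le> \<alpha>\<^sup>2"
      using ev by (auto simp: eventually_at_filter)
    ultimately have "g r \<le> \<alpha>\<^sup>2"
      by (intro tendsto_upperbound) auto
    then show "(norm (hor p q) / r)\<^sup>2 + (ver p q / r\<^sup>2)\<^sup>2 \<le> \<alpha>\<^sup>2"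
      by (simp add: g_def)
  next
    assume "(norm (hor p q) / r)\<^sup>2 + (ver p q / r\<^sup>2)\<^sup>2 \<le> \<alpha>\<^sup>2"
    then have "r \<in> G" using assms by (simp add: G_def g_def)
    then show "d_alpha \<alpha> p q \<le> r" unfolding d by (rule cInf_lower[OF _ bdd])
  qed
qed

section \<open>Doubling and the weak Besicovitch property\<close>

lemma abs_le_if_sum_squares_le:
  fixes x y c :: real
  assumes "x\<^sup>2 + y\<^sup>2 \<le> c\<^sup>2" "0 \<le> c"
  shows "\<bar>x\<bar> \<le> c" "\<bar>y\<bar> \<le> c"
proof -
  have "x\<^sup>2 \<le> c\<^sup>2" "y\<^sup>2 \<le> c\<^sup>2"
    using assms(1) zero_le_power2[of x] zero_le_power2[of y] by linarith+
  then show "\<bar>x\<bar> \<le> c" "\<bar>y\<bar> \<le> c"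
    using assms(2) by (simp_all flip: abs_le_square_iff)
qed

text \<open>Total boundedness as a finite colouring, ready for the pigeonhole principle.\<close>

lemma bounded_finite_classes:
  fixes K :: "'e::euclidean_space set"
  assumes "bounded K" "\<epsilon> > 0"
  obtains F :: "'e set" and f where "finite F" "f ` K \<subseteq> F"
    "\<And>x y. \<lbrakk>x \<in> K; y \<in> K; f x = f y\<rbrakk> \<Longrightarrow> dist x y < \<epsilon>"
proof -
  have "compact (closure K)" using assms by simp
  then obtain F where F: "finite F" "closure K \<subseteq> (\<Union>x\<in>F. ball x (\<epsilon> / 2))"
    using compact_eq_totally_bounded half_gt_zero[OF assms(2)] by metis
  then have "\<forall>x\<in>K. \<exists>c\<in>F. dist c x < \<epsilon> / 2"
    using closure_subset by (fastforce simp: subset_iff)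
  then obtain f where f: "\<And>x. x \<in> K \<Longrightarrow> f x \<in> F \<and> dist (f x) x < \<epsilon> / 2"
    by metis
  show ?thesis
  proof (rule that[of F f])
    fix x y assume "x \<in> K" "y \<in> K" "f x = f y"
    then show "dist x y < \<epsilon>"
      using f[of x] f[of y] dist_triangle_half_r[of "f x" x \<epsilon> y] by auto
  qed (use F f in auto)
qed

lemma d_alpha_le_if_scaled:
  fixes p p' :: "'n::finite heis"
  assumes "\<alpha> > 0" "r > 0" "hor p p' = r *\<^sub>R W" "ver p p' = r\<^sup>2 * T"
    and "(norm W)\<^sup>2 + T\<^sup>2 \<le> \<alpha>\<^sup>2"
  shows "d_alpha \<alpha> p p' \<le> r"
  using assms by (simp add: d_alpha_le_iff)

text \<open>Dilated by 1 / r, the points lie in the Euclidean ball of radius \<alpha>. Two of one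
  colour would be within r / 2 of each other, so the colours are distinct.\<close>

lemma d_alpha_doubling:
  fixes \<alpha> :: real
  assumes "\<alpha> > 0"
  shows "\<exists>C. doubling_d (d_alpha \<alpha> :: 'n::finite heis \<Rightarrow> 'n heis \<Rightarrow> real) C"
proof -
  \<comment> \<open>Chosen so that the vertical difference, at most \<open>\<eta>\<close> plus
    \<open>\<alpha> * \<eta> / 2\<close>, is at most \<alpha> / 8.\<close>
  define \<eta> where "\<eta> = \<alpha> / (8 * (1 + \<alpha>))"
  have \<eta>: "\<eta> > 0" "\<eta> * (1 + \<alpha>) = \<alpha> / 8"
    using assms by (auto simp: \<eta>_def field_simps)
  have \<eta>8: "\<eta> \<le> \<alpha> / 8"
    using \<eta> assms by (smt (verit) mult_left_le_one_le mult_le_cancel_left1)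
  obtain K and F :: "((real^'n) \<times> (real^'n)) \<times> real \<Rightarrow> ((real^'n) \<times> (real^'n)) \<times> real"
    where F: "finite K" "F ` cball 0 \<alpha> \<subseteq> K"
      "\<And>x y. \<lbrakk>x \<in> cball 0 \<alpha>; y \<in> cball 0 \<alpha>; F x = F y\<rbrakk> \<Longrightarrow> dist x y < \<eta>"
    by (rule bounded_finite_classes[OF bounded_cball \<eta>(1)]) (rule that)
  show ?thesis
    unfolding doubling_d_def
  proof (intro exI[of _ "card K"] allI impI)
    fix q r and S :: "'n heis set"
    assume r: "r > 0" and near: "\<forall>p\<in>S. d_alpha \<alpha> q p \<le> r"
      and sep: "\<forall>p\<in>S. \<forall>p'\<in>S. p \<noteq> p' \<longrightarrow> d_alpha \<alpha> p p' > r / 2"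
    define w where "w p = (1 / r) *\<^sub>R hor q p" for p
    define t where "t p = ver q p / r\<^sup>2" for p
    have in_ball: "(w p, t p) \<in> cball 0 \<alpha>" if "p \<in> S" for p
    proof -
      have "(norm (w p))\<^sup>2 + (t p)\<^sup>2 \<le> \<alpha>\<^sup>2"
        using bspec[OF near that] r assms by (simp add: d_alpha_le_iff w_def t_def power_divide)
      then show ?thesis
        using assms by (simp add: norm_Pair real_le_lsqrt)
    qed
    have "inj_on (\<lambda>p. F (w p, t p)) S"
    proof (rule inj_onI, rule ccontr)
      fix p p' assume p: "p \<in> S" "p' \<in> S" "F (w p, t p) = F (w p', t p')" "p \<noteq> p'"
      have "dist (w p, t p) (w p', t p') < \<eta>"
        using F(3) in_ball p by blast
      then have dw: "norm (w p - w p') < \<eta>" and dt: "\<bar>t p - t p'\<bar> < \<eta>"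
        using dist_fst_le[of "(w p, t p)" "(w p', t p')"] dist_snd_le[of "(w p, t p)" "(w p', t p')"]
        by (auto simp: dist_norm)
      have "norm (w p) \<le> \<alpha>"
        using in_ball[OF p(1)] norm_fst_le[of "w p" "t p"] by simp
      then have "\<bar>symp (w p) (w p')\<bar> \<le> \<alpha> * \<eta>"
        using abs_symp_le_diff[of "w p" "w p'"] dw assms
        by (smt (verit) mult_mono norm_ge_zero)
      then have "\<bar>t p' - t p - symp (w p) (w p') / 2\<bar> \<le> \<eta> * (1 + \<alpha>)"
        using dt mult_pos_pos[OF \<eta>(1) assms] unfolding distrib_left mult.commute[of \<alpha>] by linarith
      then have T: "(t p' - t p - symp (w p) (w p') / 2)\<^sup>2 \<le> (\<alpha> / 8)\<^sup>2"
        using \<eta>(2) assms by (simp flip: abs_le_square_iff)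
      have W: "(norm (w p' - w p))\<^sup>2 \<le> (\<alpha> / 8)\<^sup>2"
        using dw \<eta>8 by (intro power_mono) (auto simp: norm_minus_commute)
      have hq: "hor q x = r *\<^sub>R w x" "ver q x = r\<^sup>2 * t x" for x
        using r by (simp_all add: w_def t_def)
      \<comment> \<open>Passing from scale r to r / 2 doubles the horizontal and quadruples the
        vertical part; the squares total at most (4 + 16) / 64 of \<alpha>^2.\<close>
      have "d_alpha \<alpha> p p' \<le> r / 2"
      proof (rule d_alpha_le_if_scaled[OF assms])
        show "hor p p' = (r / 2) *\<^sub>R (2 *\<^sub>R (w p' - w p))"
          unfolding hor_translate[of p p' q] hq by (simp add: scaleR_diff_right)
        show "ver p p' = (r / 2)\<^sup>2 * (4 * (t p' - t p - symp (w p) (w p') / 2))"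
          unfolding ver_translate[of p p' q] hq
          by (simp add: symp_scaleR field_simps power2_eq_square)
        show "(norm (2 *\<^sub>R (w p' - w p)))\<^sup>2 + (4 * (t p' - t p - symp (w p) (w p') / 2))\<^sup>2 \<le> \<alpha>\<^sup>2"
        proof -
          have "(norm (2 *\<^sub>R (w p' - w p)))\<^sup>2 = 4 * (norm (w p' - w p))\<^sup>2"
            by (simp add: power_mult_distrib)
          moreover have "(4 * (t p' - t p - symp (w p) (w p') / 2))\<^sup>2
              = 16 * (t p' - t p - symp (w p) (w p') / 2)\<^sup>2"
            unfolding power_mult_distrib by simp
          moreover have "(\<alpha> / 8)\<^sup>2 = \<alpha>\<^sup>2 / 64"
            by (simp add: power_divide)
          ultimately show ?thesis
            using T W zero_le_power2[of \<alpha>] by linarith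
        qed
      qed (use r in simp)
      then show False using sep p by force
    qed
    moreover have "(\<lambda>p. F (w p, t p)) ` S \<subseteq> K"
      using F(2) in_ball by blast
    ultimately show "finite S \<and> card S \<le> card K"
      using F(1) by (simp add: inj_on_finite card_inj_on_le)
  qed
qed

text \<open>Nearness of the directions is what keeps the symplectic term below the inner product near the
  poles, where w and w' are small; nearness of w and w' alone would not suffice there.\<close>

lemma dilated_neighbour_in_unit_ball:
  fixes w w' :: "'b::real_inner \<times> 'b"
  assumes "\<alpha> > 0" "0 < s" "s \<le> 1"
    and w: "(norm w)\<^sup>2 + t\<^sup>2 = \<alpha>\<^sup>2" and w': "(norm w')\<^sup>2 + t'\<^sup>2 = \<alpha>\<^sup>2"
    and dw: "norm (w - w') \<le> \<alpha> / 2" and dt: "\<bar>t - t'\<bar> \<le> \<alpha> / 2"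
    and du: "norm (sgn w - sgn w') \<le> \<epsilon>" and \<epsilon>: "0 < \<epsilon>" "\<epsilon> \<le> 1 / 16" "\<alpha> * \<epsilon> \<le> 1 / 16"
  shows "(norm (w' - s *\<^sub>R w))\<^sup>2 + (t' - s\<^sup>2 * t - s * symp w w' / 2)\<^sup>2 \<le> \<alpha>\<^sup>2"
proof -
  define a where "a = norm w"
  define b where "b = norm w'"
  define c where "c = w \<bullet> w'"
  define o' where "o' = symp w w'"
  have ab: "0 \<le> a" "0 \<le> b" by (simp_all add: a_def b_def)
  have sgn: "w = a *\<^sub>R sgn w" "w' = b *\<^sub>R sgn w'"
    by (cases "w = 0"; simp add: a_def sgn_div_norm) (cases "w' = 0"; simp add: b_def sgn_div_norm)
  have a2: "a\<^sup>2 + t\<^sup>2 = \<alpha>\<^sup>2" and b2: "b\<^sup>2 + t'\<^sup>2 = \<alpha>\<^sup>2"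
    using w w' by (simp_all add: a_def b_def)
  have t: "\<bar>t\<bar> \<le> \<alpha>" and t': "\<bar>t'\<bar> \<le> \<alpha>" and a\<alpha>: "a \<le> \<alpha>" and b\<alpha>: "b \<le> \<alpha>"
    using abs_le_if_sum_squares_le[of a t \<alpha>] abs_le_if_sum_squares_le[of b t' \<alpha>] a2 b2 assms(1) by auto
  have ab\<alpha>: "a * b \<le> \<alpha>\<^sup>2"
    unfolding power2_eq_square using ab a\<alpha> b\<alpha> by (intro mult_mono) auto
  \<comment> \<open>Law of cosines for the unit directions: their inner product is at least 1 -
    \<epsilon>^2 / 2.\<close>
  have c: "c \<ge> (1 - \<epsilon>) * (a * b)"
  proof (cases "w = 0 \<or> w' = 0")
    case True
    then show ?thesis by (auto simp: a_def b_def c_def)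
  next
    case False
    have "(norm (sgn w - sgn w'))\<^sup>2 = 2 - 2 * (sgn w \<bullet> sgn w')"
      using False by (simp add: power2_norm_eq_inner inner_diff inner_commute)
        (simp add: dot_square_norm norm_sgn)
    moreover have "(norm (sgn w - sgn w'))\<^sup>2 \<le> \<epsilon>\<^sup>2"
      using du by (intro power_mono) auto
    moreover have "\<epsilon>\<^sup>2 \<le> \<epsilon>"
      using \<epsilon> by (simp add: power2_eq_square mult_left_le)
    ultimately have "sgn w \<bullet> sgn w' \<ge> 1 - \<epsilon>" using \<epsilon> by linarith
    moreover have "c = (a * b) * (sgn w \<bullet> sgn w')"
      unfolding c_def by (subst sgn(1), subst sgn(2)) simp
    ultimately show ?thesis
      using ab by (metis mult.commute mult_left_mono mult_nonneg_nonneg)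
  qed
  \<comment> \<open>Estimating on the unit directions keeps the factor \<open>a * b\<close>, so the
    bound decays at the poles just as the one for \<open>c\<close> does.\<close>
  have o1: "\<bar>o'\<bar> \<le> \<epsilon> * (a * b)"
  proof -
    have "norm (sgn w) \<le> 1" by (simp add: norm_sgn)
    then have "\<bar>symp (sgn w) (sgn w')\<bar> \<le> \<epsilon>"
      using abs_symp_le_diff[of "sgn w" "sgn w'"] du
      by (smt (verit) mult_left_le_one_le norm_ge_zero)
    moreover have "o' = (a * b) * symp (sgn w) (sgn w')"
      unfolding o'_def by (subst sgn(1), subst sgn(2)) (simp add: symp_scaleR)
    ultimately show ?thesis
      using ab mult_left_mono[of "\<bar>symp (sgn w) (sgn w')\<bar>" \<epsilon> "a * b"]
      by (simp add: abs_mult mult.commute[of \<epsilon>])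
  qed
  have \<alpha>o: "\<alpha> * \<bar>o'\<bar> \<le> a * b / 16"
  proof -
    have "\<alpha> * \<bar>o'\<bar> \<le> (\<alpha> * \<epsilon>) * (a * b)"
      using o1 assms(1) by (simp add: mult.assoc)
    also have "\<dots> \<le> 1 / 16 * (a * b)"
      using \<epsilon>(3) ab by (intro mult_right_mono) auto
    finally show ?thesis by simp
  qed
  have to: "\<bar>t * o'\<bar> \<le> a * b / 16" "\<bar>t' * o'\<bar> \<le> a * b / 16"
    using \<alpha>o mult_right_mono[OF t, of "\<bar>o'\<bar>"] mult_right_mono[OF t', of "\<bar>o'\<bar>"]
    by (simp_all add: abs_mult)
  have oo: "o'\<^sup>2 \<le> a * b / 16"
  proof -
    have "\<bar>o'\<bar> \<le> \<epsilon> * \<alpha>\<^sup>2"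
      using o1 mult_left_mono[OF ab\<alpha>, of \<epsilon>] \<epsilon> by linarith
    then have "\<bar>o'\<bar> * \<bar>o'\<bar> \<le> (\<epsilon> * \<alpha>\<^sup>2) * \<bar>o'\<bar>"
      by (intro mult_right_mono) auto
    also have "\<dots> = (\<alpha> * \<epsilon>) * (\<alpha> * \<bar>o'\<bar>)"
      by (simp add: power2_eq_square)
    also have "\<dots> \<le> 1 * (\<alpha> * \<bar>o'\<bar>)"
      using \<epsilon> assms(1) by (intro mult_right_mono) auto
    finally show ?thesis using \<alpha>o by (simp add: power2_eq_square)
  qed
  have quad: "(s * t + o' / 2)\<^sup>2 \<le> t\<^sup>2 + a * b / 8"
  proof -
    have "(s * t + o' / 2)\<^sup>2 = s\<^sup>2 * t\<^sup>2 + s * (t * o') + o'\<^sup>2 / 4"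
      by (simp add: power2_eq_square algebra_simps)
    moreover have "s\<^sup>2 * t\<^sup>2 \<le> t\<^sup>2"
      using assms(2,3) by (intro mult_left_le_one_le) (auto simp: power_le_one)
    moreover have "s * (t * o') \<le> a * b / 16"
    proof -
      have "s * (t * o') \<le> s * \<bar>t * o'\<bar>" using assms(2) by simp
      also have "\<dots> \<le> \<bar>t * o'\<bar>" using assms(2,3) by (intro mult_left_le_one_le) auto
      finally show ?thesis using to by simp
    qed
    ultimately show ?thesis using oo mult_nonneg_nonneg[OF ab] by linarith
  qed
  \<comment> \<open>29 / 16 = 2 (1 - 1/16) - 1/16, the losses coming from \<open>c\<close> and from
    \<open>t' * o'\<close>.\<close>
  have gain: "2 * c + t' * o' \<ge> s * (29 / 16 * (a * b))"
  proof -
    have "\<epsilon> * (a * b) \<le> a * b / 16"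
      using mult_right_mono[OF \<epsilon>(2), of "a * b"] ab by simp
    then have "2 * c + t' * o' \<ge> 29 / 16 * (a * b)"
      using c to(2) by (simp add: algebra_simps abs_le_iff)
    moreover have "s * (29 / 16 * (a * b)) \<le> 29 / 16 * (a * b)"
      using assms(2,3) ab by (intro mult_left_le_one_le) auto
    ultimately show ?thesis by linarith
  qed
  \<comment> \<open>On the sphere, 2ab + 2tt' = 2\<alpha>^2 - (a - b)^2 - (t - t')^2 \<ge> 3/2
    \<alpha>^2. The missing 3/16 + 1/8 = 5/16 of ab costs at most 5/16 \<alpha>^2, which leaves more
    than \<alpha>^2 = a^2 + t^2.\<close>
  have close: "a\<^sup>2 + t\<^sup>2 + a * b / 8 \<le> 29 / 16 * (a * b) + 2 * (t * t')"
  proof -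
    have "\<bar>a - b\<bar> \<le> \<alpha> / 2"
      using dw norm_triangle_ineq3[of w w'] by (simp add: a_def b_def)
    then have "(a - b)\<^sup>2 \<le> (\<alpha> / 2)\<^sup>2" "(t - t')\<^sup>2 \<le> (\<alpha> / 2)\<^sup>2"
      using dt assms(1) by (simp_all flip: abs_le_square_iff)
    moreover have "(a - b)\<^sup>2 = a\<^sup>2 + b\<^sup>2 - 2 * (a * b)" "(t - t')\<^sup>2 = t\<^sup>2 + t'\<^sup>2 - 2 * (t * t')"
        "(\<alpha> / 2)\<^sup>2 = \<alpha>\<^sup>2 / 4"
      by (simp_all add: power2_diff power_divide)
    ultimately show ?thesis
      using a2 b2 ab\<alpha> zero_le_power2[of \<alpha>] by linarith
  qed
  \<comment> \<open>Multiplied by s, this chain is the claim after expanding both squares and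
    cancelling b^2 + t'^2 = \<alpha>^2.\<close>
  have "s * (a\<^sup>2 + (s * t + o' / 2)\<^sup>2) \<le> s * (29 / 16 * (a * b) + 2 * (t * t'))"
    using close quad assms(2) by (intro mult_left_mono) auto
  also have "\<dots> \<le> 2 * c + t' * o' + s * (2 * (t * t'))"
    using gain by (simp add: distrib_left)
  finally have "s * (s * (a\<^sup>2 + (s * t + o' / 2)\<^sup>2)) \<le> s * (2 * c + t' * o' + s * (2 * (t * t')))"
    using assms(2) by (intro mult_left_mono) auto
  moreover have "(norm (w' - s *\<^sub>R w))\<^sup>2 = b\<^sup>2 - s * (2 * c) + s * (s * a\<^sup>2)"
    unfolding a_def b_def c_def power2_norm_eq_inner
    by (simp add: inner_diff inner_commute algebra_simps power2_eq_square)
  moreover have "(t' - s\<^sup>2 * t - s * o' / 2)\<^sup>2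
      = t'\<^sup>2 - s * (t' * o' + s * (2 * (t * t'))) + s * (s * (s * t + o' / 2)\<^sup>2)"
    by (simp add: power2_eq_square algebra_simps)
  ultimately show ?thesis
    using b2 unfolding o'_def[symmetric] distrib_left by linarith
qed

lemma d_alpha_weak_BCP:
  fixes \<alpha> :: real
  assumes "\<alpha> > 0" and dist: "is_distance (d_alpha \<alpha> :: 'n::finite heis \<Rightarrow> 'n heis \<Rightarrow> real)"
  shows "\<exists>N. weak_BCP (d_alpha \<alpha> :: 'n heis \<Rightarrow> 'n heis \<Rightarrow> real) N"
proof -
  define \<epsilon> where "\<epsilon> = min (1 / 16) (1 / (16 * \<alpha>))"
  have \<epsilon>: "0 < \<epsilon>" "\<epsilon> \<le> 1 / 16" "\<alpha> * \<epsilon> \<le> 1 / 16"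
  proof -
    have "\<alpha> * \<epsilon> \<le> \<alpha> * (1 / (16 * \<alpha>))"
      using assms(1) by (intro mult_left_mono) (auto simp: \<epsilon>_def)
    then show "0 < \<epsilon>" "\<epsilon> \<le> 1 / 16" "\<alpha> * \<epsilon> \<le> 1 / 16"
      using assms(1) by (auto simp: \<epsilon>_def)
  qed
  define \<eta> where "\<eta> = min \<epsilon> (\<alpha> / 2)"
  have \<eta>: "\<eta> > 0" "\<eta> \<le> \<epsilon>" "\<eta> \<le> \<alpha> / 2" using \<epsilon> assms(1) by (auto simp: \<eta>_def)
  \<comment> \<open>The third factor holds the direction \<open>sgn (w p)\<close>, so that equal
    colours also force close directions.\<close>
  let ?K = "cball 0 \<alpha> \<times> cball 0 \<alpha> \<times> cball 0 1 :: (((real^'n) \<times> (real^'n)) \<times> real \<times> ((real^'n) \<times> (real^'n))) set"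
  have "bounded ?K" by (intro bounded_Times bounded_cball)
  then obtain K and F :: "_ \<Rightarrow> ((real^'n) \<times> (real^'n)) \<times> real \<times> ((real^'n) \<times> (real^'n))"
    where F: "finite K" "F ` ?K \<subseteq> K" "\<And>x y. \<lbrakk>x \<in> ?K; y \<in> ?K; F x = F y\<rbrakk> \<Longrightarrow> dist x y < \<eta>"
    by (rule bounded_finite_classes[OF _ \<eta>(1)]) (rule that)
  have nonneg: "0 \<le> d_alpha \<alpha> p q" and d0: "d_alpha \<alpha> p q = 0 \<longleftrightarrow> p = q" for p q :: "'n heis"
    using dist unfolding is_distance_def by blast+
  show ?thesis
    unfolding weak_BCP_def
  \<comment> \<open>The extra 1 is for q in S: another p in S would give d(q,p) > d(q,p), so S is
    then just {q}.\<close>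
  proof (intro exI[of _ "card K + 1"] allI impI)
    fix q and S :: "'n heis set"
    assume sep: "\<forall>p\<in>S. \<forall>p'\<in>S. p \<noteq> p' \<longrightarrow> d_alpha \<alpha> p p' > max (d_alpha \<alpha> q p) (d_alpha \<alpha> q p')"
    show "finite S \<and> card S \<le> card K + 1"
    proof (cases "q \<in> S")
      case True
      have "S \<subseteq> {q}" using bspec[OF sep True] by fastforce
      then show ?thesis
        using card_mono[of "{q}" S] finite_subset[of S "{q}"] by auto
    next
      case False
      define r where "r p = d_alpha \<alpha> q p" for p
      have rpos: "r p > 0" if "p \<in> S" for p
        using nonneg[of q p] d0[of q p] False that unfolding r_def by force
      define w where "w p = (1 / r p) *\<^sub>R hor q p" for p
      define t where "t p = ver q p / (r p)\<^sup>2" for p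
      \<comment> \<open>The distance is the radius of exact equality: \<open>x\<close> is
        admissible, and a smaller admissible radius contradicts strict monotonicity.\<close>
      have sphere: "(norm (w p))\<^sup>2 + (t p)\<^sup>2 = \<alpha>\<^sup>2" if p: "p \<in> S" for p
      proof -
        have "norm (hor q p) \<noteq> 0 \<or> ver q p \<noteq> 0"
          using hor_ver_eq_0[of q p] p False by auto
        then obtain x where x: "x > 0" "(norm (hor q p) / x)\<^sup>2 + (ver q p / x\<^sup>2)\<^sup>2 = \<alpha>\<^sup>2"
          using gauge_radius_exists[OF assms(1)] by metis
        have "r p \<le> x"
          unfolding r_def using d_alpha_le_iff[OF assms(1) x(1), of q p] x(2) by simp
        moreover have "\<not> r p < x"
          using gauge_strict_antimono[OF rpos[OF p], of x "norm (hor q p)" "ver q p"] x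
            d_alpha_le_iff[OF assms(1) rpos[OF p], of q p] \<open>norm (hor q p) \<noteq> 0 \<or> ver q p \<noteq> 0\<close>
          by (auto simp: r_def)
        ultimately have "r p = x" by simp
        then show ?thesis using x by (simp add: w_def t_def power_divide)
      qed
      have in_K: "(w p, t p, sgn (w p)) \<in> ?K" if "p \<in> S" for p
      proof -
        have "norm (w p) \<le> \<alpha>" "\<bar>t p\<bar> \<le> \<alpha>"
          using abs_le_if_sum_squares_le[of "norm (w p)" "t p" \<alpha>] sphere[OF that] assms(1) by auto
        then show ?thesis by (simp add: norm_sgn)
      qed
      have hq: "hor q p = r p *\<^sub>R w p" "ver q p = (r p)\<^sup>2 * t p" if "p \<in> S" for p
        using rpos[OF that] by (simp_all add: w_def t_def)
      \<comment> \<open>The farther point p' sets the scale: dilation by 1 / r p' sends it to (w',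
        t') and p to the s-dilate of (w, t) with s \<le> 1. Then p and p' are within r p' of each
        other, against the separation.\<close>
      have no_pair: False if p: "p \<in> S" "p' \<in> S" "p \<noteq> p'" "r p \<le> r p'"
        and cls: "F (w p, t p, sgn (w p)) = F (w p', t p', sgn (w p'))" for p p'
      proof -
        have "dist (w p, t p, sgn (w p)) (w p', t p', sgn (w p')) < \<eta>"
          using F(3) in_K p(1,2) cls by blast
        then have "dist (w p) (w p') < \<eta> \<and> dist (t p) (t p') < \<eta> \<and> dist (sgn (w p)) (sgn (w p')) < \<eta>"
          using dist_fst_le[of "(w p, t p, sgn (w p))" "(w p', t p', sgn (w p'))"]
            dist_snd_le[of "(w p, t p, sgn (w p))" "(w p', t p', sgn (w p'))"]
            dist_fst_le[of "(t p, sgn (w p))" "(t p', sgn (w p'))"]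
            dist_snd_le[of "(t p, sgn (w p))" "(t p', sgn (w p'))"]
          by simp
        then have near: "norm (w p - w p') \<le> \<alpha> / 2" "\<bar>t p - t p'\<bar> \<le> \<alpha> / 2"
            "norm (sgn (w p) - sgn (w p')) \<le> \<epsilon>"
          using \<eta> by (auto simp: dist_norm)
        define s where "s = r p / r p'"
        have s: "0 < s" "s \<le> 1" "r p = r p' * s"
          using rpos[OF p(1)] rpos[OF p(2)] p(4) by (simp_all add: s_def)
        have "d_alpha \<alpha> p p' \<le> r p'"
        proof (rule d_alpha_le_if_scaled[OF assms(1) rpos[OF p(2)]])
          show "hor p p' = r p' *\<^sub>R (w p' - s *\<^sub>R w p)"
            unfolding hor_translate[of p p' q] hq[OF p(1)] hq[OF p(2)] s(3)
            by (simp add: scaleR_diff_right)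
          show "ver p p' = (r p')\<^sup>2 * (t p' - s\<^sup>2 * t p - s * symp (w p) (w p') / 2)"
            unfolding ver_translate[of p p' q] hq[OF p(1)] hq[OF p(2)] s(3)
            by (simp add: symp_scaleR field_simps power2_eq_square)
          show "(norm (w p' - s *\<^sub>R w p))\<^sup>2 + (t p' - s\<^sup>2 * t p - s * symp (w p) (w p') / 2)\<^sup>2 \<le> \<alpha>\<^sup>2"
            by (rule dilated_neighbour_in_unit_ball[OF assms(1) s(1,2) sphere[OF p(1)] sphere[OF p(2)]
                  near \<epsilon>])
        qed
        then show False using sep p(1-3) by (force simp: r_def)
      qed
      have "inj_on (\<lambda>p. F (w p, t p, sgn (w p))) S"
      proof (rule inj_onI, rule ccontr)
        fix p p'
        assume "p \<in> S" "p' \<in> S" "F (w p, t p, sgn (w p)) = F (w p', t p', sgn (w p'))" "p \<noteq> p'"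
        then show False
          using no_pair[of p p'] no_pair[of p' p] by (cases "r p \<le> r p'") auto
      qed
      moreover have "(\<lambda>p. F (w p, t p, sgn (w p))) ` S \<subseteq> K"
        using F(2) in_K by blast
      ultimately have "finite S \<and> card S \<le> card K"
        using F(1) by (simp add: inj_on_finite card_inj_on_le)
      then show ?thesis by simp
    qed
  qed
qed

theorem theorem1p5:
  fixes \<alpha> :: real
  assumes "\<alpha> > 0"
    and "is_distance (d_alpha \<alpha> :: 'n::finite heis \<Rightarrow> 'n heis \<Rightarrow> real)"
  shows "BCP (d_alpha \<alpha> :: 'n::finite heis \<Rightarrow> 'n heis \<Rightarrow> real)"
proof -
  obtain C N where "doubling_d (d_alpha \<alpha> :: 'n heis \<Rightarrow> 'n heis \<Rightarrow> real) C"
    "weak_BCP (d_alpha \<alpha> :: 'n heis \<Rightarrow> 'n heis \<Rightarrow> real) N"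
    using d_alpha_doubling[OF assms(1)] d_alpha_weak_BCP[OF assms] by metis
  then show ?thesis
    by (rule BCP_if_doubling_weak_BCP[OF assms(2)])
qed

end
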